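(* For $n,k\in\mathbb{N}$, $\varepsilon>0$, $\tilde d_{max}\in\mathbb{Z}_{\ge 0}$ and a graph $G$ on $n$ nodes, let $\hat f_{k\star}(G,\varepsilon,\tilde d_{max})$ be the output of $\mathsf{LocalLap}_{k\star}$. Then for all $k\in\mathbb{N}$, $\varepsilon>0$, $\tilde d_{max}\in\mathbb{Z}_{\ge 0}$, and all graphs $G$ on $n$ nodes whose maximum degree $d_{max}$ is at most $\tilde d_{max}$, $$\mathbb{E}\big[(\hat f_{k\star}(G,\varepsilon,\tilde d_{max})-f_{k\star}(G))^2\big]=O\!\left(\frac{n\,\tilde d_{max}^{\,2k-2}}{\varepsilon^2}\right),$$ where the expectation is over the randomness of the algorithm and the implied constant is absolute.
   Context: $\mathbb N=\{1,2,\dots\}$; convention $0^0=1$. Graphs are undirected on nodes (users) $v_1,\dots,v_n$, with symmetric adjacency matrix $\mathbf{A}=(a_{i,j})\in\{0,1\}^{n\times n}$ with zero diagonal; the neighbor list $\mathbf{a}_i$ of $v_i$ is the $i$-th row of $\mathbf{A}$. A $k$-star consists of a central node together with a set of $k$ of its neighbors; $f_{k\star}(G)=\sum_{i=1}^n\binom{\deg(v_i)}{k}$ is the number of $k$-stars in $G$. $\mathrm{Lap}(b)$ denotes a Laplace random variable with mean $0$ and scale $b$ (with $\mathrm{Lap}(0)=0$). Graph projection: given a neighbor list $\mathbf{a}_i$ with $d_i$ ones and $\tilde d_{max}$, if $d_i>\tilde d_{max}$ then $\tilde d_{max}$ of the $d_i$ neighbors are selected uniformly at random and the other ones are set to $0$;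 otherwise $\mathbf{a}_i$ is unchanged. Algorithm $\mathsf{LocalLap}_{k\star}$: let $\Delta=\binom{\tilde d_{max}}{k-1}$. Each user $v_i$ independently applies graph projection with $\tilde d_{max}$ to $\mathbf{a}_i$, lets $d_i=\sum_{j=1}^n a_{i,j}$ (after projection) and $r_i=\binom{d_i}{k}$, and releases $\hat r_i=r_i+\mathrm{Lap}(\Delta/\varepsilon)$ (independent noise across users). The output is $\sum_{i=1}^n\hat r_i$. *)

theory Defs
  imports "HOL-Probability.Probability"
begin

text \<open>A graph on the nodes \<open>1, \<dots>, n\<close> is given by its adjacency matrix, a function on index pairs;
  only the entries with both indices in \<open>{1..n}\<close> are ever inspected. The neighbor list of
  node \<open>i\<close> is the row \<open>A i\<close>.\<close>

definition adjacency_matrix :: "nat \<Rightarrow> (nat \<Rightarrow> nat \<Rightarrow> nat) \<Rightarrow> bool" where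
  "adjacency_matrix n A \<longleftrightarrow>
     (\<forall>i\<in>{1..n}. \<forall>j\<in>{1..n}. A i j \<in> {0, 1}) \<and>
     (\<forall>i\<in>{1..n}. \<forall>j\<in>{1..n}. A i j = A j i) \<and>
     (\<forall>i\<in>{1..n}. A i i = 0)"

definition neighbors :: "nat \<Rightarrow> (nat \<Rightarrow> nat) \<Rightarrow> nat set" where
  "neighbors n a = {j \<in> {1..n}. a j = 1}"

definition node_degree :: "nat \<Rightarrow> (nat \<Rightarrow> nat \<Rightarrow> nat) \<Rightarrow> nat \<Rightarrow> nat" where
  "node_degree n A i = card (neighbors n (A i))"

definition max_degree :: "nat \<Rightarrow> (nat \<Rightarrow> nat \<Rightarrow> nat) \<Rightarrow> nat" where
  "max_degree n A = Max (node_degree n A ` {1..n})"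

definition kstar_count :: "nat \<Rightarrow> nat \<Rightarrow> (nat \<Rightarrow> nat \<Rightarrow> nat) \<Rightarrow> nat" where
  "kstar_count k n A = (\<Sum>i=1..n. node_degree n A i choose k)"

lemma kstar_count_eq_card:
  "kstar_count k n A = card (SIGMA i:{1..n}. {S. S \<subseteq> neighbors n (A i) \<and> card S = k})"
proof -
  have "finite (neighbors n a)" for a
    by (simp add: neighbors_def)
  then show ?thesis
    by (simp add: kstar_count_def node_degree_def n_subsets)
qed

text \<open>The Laplace distribution with mean \<open>0\<close> and scale \<open>b \<ge> 0\<close>; scale \<open>0\<close> is the point mass
  at \<open>0\<close>.\<close>

definition laplace :: "real \<Rightarrow> real measure" where
  "laplace b =
     (if b = 0 then return borel 0
      else density lborel (\<lambda>x. ennreal (exp (- \<bar>x\<bar> / b) / (2 * b))))"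

definition graph_projection :: "nat \<Rightarrow> nat \<Rightarrow> (nat \<Rightarrow> nat) \<Rightarrow> (nat \<Rightarrow> nat) pmf" where
  "graph_projection n dmax a =
     (if card (neighbors n a) > dmax
      then map_pmf (\<lambda>S j. if j \<in> neighbors n a - S then 0 else a j)
             (pmf_of_set {S. S \<subseteq> neighbors n a \<and> card S = dmax})
      else return_pmf a)"

text \<open>The distribution of the noisy count released by the user with neighbor list \<open>a\<close>.\<close>

definition user_release :: "nat \<Rightarrow> nat \<Rightarrow> real \<Rightarrow> nat \<Rightarrow> (nat \<Rightarrow> nat) \<Rightarrow> real measure" where
  "user_release n k \<epsilon> dmax a =
     (let \<Delta> = real (dmax choose (k - 1)) in
      bind (measure_pmf (graph_projection n dmax a))
        (\<lambda>a'. let d = (\<Sum>j=1..n. a' j); r = real (d choose k)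
               in distr (laplace (\<Delta> / \<epsilon>)) borel (\<lambda>z. r + z)))"

text \<open>The output distribution: the users act independently, hence the product measure.\<close>

definition local_lap_kstar ::
    "nat \<Rightarrow> nat \<Rightarrow> (nat \<Rightarrow> nat \<Rightarrow> nat) \<Rightarrow> real \<Rightarrow> nat \<Rightarrow> real measure" where
  "local_lap_kstar k n A \<epsilon> dmax =
     distr (\<Pi>\<^sub>M i\<in>{1..n}. user_release n k \<epsilon> dmax (A i)) borel (\<lambda>x. \<Sum>i=1..n. x i)"

lemma sets_laplace [measurable_cong]: "sets (laplace b) = sets borel"
  by (simp add: laplace_def)

lemma prob_space_laplace:
  assumes "b \<ge> 0"
  shows "prob_space (laplace b)"
proof (cases "b = 0")
  case True
  then show ?thesis
    by (simp add: laplace_def prob_space_return)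
next
  case False
  with assms have b: "b > 0" by simp
  let ?e = "exponential_density (1 / b)"
  interpret E: prob_space "density lborel ?e"
    using b by (intro prob_space_exponential_density) simp
  have e1: "(\<integral>\<^sup>+x. ennreal (?e x) \<partial>lborel) = 1"
    using E.emeasure_space_1 by (simp add: emeasure_density)
  have e2: "(\<integral>\<^sup>+x. ennreal (?e (- x)) \<partial>lborel) = 1"
    using nn_integral_real_affine[of "\<lambda>x. ennreal (?e x)" "- 1" 0] e1 by simp
  have "AE x in lborel. x \<noteq> (0 :: real)"
    by (rule AE_lborel_singleton)
  then have "AE x in lborel. ennreal (exp (- \<bar>x\<bar> / b) / (2 * b)) =
      ennreal (1 / 2) * (ennreal (?e x) + ennreal (?e (- x)))"
  proof eventually_elim
    fix x :: real
    assume "x \<noteq> 0"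
    then have "exp (- \<bar>x\<bar> / b) / (2 * b) = 1 / 2 * (?e x + ?e (- x))"
      using b by (auto simp: exponential_density_def field_simps abs_if)
    moreover have "?e x \<ge> 0" "?e (- x) \<ge> 0"
      using b by (auto intro!: exponential_density_nonneg)
    ultimately show "ennreal (exp (- \<bar>x\<bar> / b) / (2 * b)) =
        ennreal (1 / 2) * (ennreal (?e x) + ennreal (?e (- x)))"
      by (metis ennreal_mult ennreal_plus add_nonneg_nonneg half_gt_zero_iff less_eq_real_def zero_less_one)
  qed
  then have "(\<integral>\<^sup>+x. ennreal (exp (- \<bar>x\<bar> / b) / (2 * b)) \<partial>lborel) =
      (\<integral>\<^sup>+x. ennreal (1 / 2) * (ennreal (?e x) + ennreal (?e (- x))) \<partial>lborel)"
    by (rule nn_integral_cong_AE)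
  also have "\<dots> = ennreal (1 / 2) * (1 + 1)"
    by (subst nn_integral_cmult, measurable, subst nn_integral_add) (simp_all add: e1 e2)
  also have "\<dots> = ennreal (1 / 2) * ennreal 2"
    by simp
  also have "\<dots> = 1"
    by (subst ennreal_mult[symmetric]) auto
  finally show ?thesis
    using False by (auto intro!: prob_spaceI simp: laplace_def emeasure_density)
qed

lemma prob_space_user_release:
  assumes "\<epsilon> > 0"
  shows "prob_space (user_release n k \<epsilon> dmax a)" and "sets (user_release n k \<epsilon> dmax a) = sets borel"
proof -
  let ?L = "laplace (real (dmax choose (k - 1)) / \<epsilon>)"
  define K where "K = (\<lambda>a'. distr ?L borel (\<lambda>z. real ((\<Sum>j=1..n. a' j) choose k) + z))"
  interpret L: prob_space ?L
    using assms by (intro prob_space_laplace) simp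
  have K: "prob_space (K a')" "sets (K a') = sets borel" for a'
    unfolding K_def by (rule L.prob_space_distr) measurable
  have "K \<in> measurable (measure_pmf p) (subprob_algebra borel)" for p
    by (auto simp: space_subprob_algebra K prob_space_imp_subprob_space)
  moreover have "user_release n k \<epsilon> dmax a = bind (measure_pmf (graph_projection n dmax a)) K"
    by (simp add: user_release_def K_def Let_def)
  ultimately show "prob_space (user_release n k \<epsilon> dmax a)"
      and "sets (user_release n k \<epsilon> dmax a) = sets borel"
    using K by (auto intro!: measure_pmf.prob_space_bind simp: sets_bind[where N = borel])
qed

lemma prob_space_local_lap_kstar:
  assumes "\<epsilon> > 0"
  shows "prob_space (local_lap_kstar k n A \<epsilon> dmax)"
proof -
  have [measurable_cong]: "sets (user_release n k \<epsilon> dmax a) = sets borel" for a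
    using assms by (rule prob_space_user_release)
  interpret prob_space "\<Pi>\<^sub>M i\<in>{1..n}. user_release n k \<epsilon> dmax (A i)"
    using assms by (intro prob_space_PiM prob_space_user_release)
  show ?thesis
    unfolding local_lap_kstar_def by (rule prob_space_distr) measurable
qed

end

theory Submission
  imports Defs
begin

text \<open>
  When the maximum degree is at most \<open>dmax\<close>, the projection changes nothing, so user \<open>i\<close> releases
  \<open>deg i choose k\<close> plus Laplace noise and the error of the output is a sum of \<open>n\<close> independent
  centred Laplace variables of scale \<open>b = (dmax choose (k - 1)) / \<epsilon>\<close>. Its second moment is therefore
  exactly \<open>2 n b\<^sup>2\<close>, and \<open>dmax choose (k - 1) \<le> dmax ^ (k - 1)\<close> gives the claim with constant \<open>2\<close>.
\<close>

text \<open>The density vanishes on the negative axis, so the integrand is nonnegative even for odd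
  \<open>i\<close>. The nonnegative integral of the Erlang moment with shape 0 therefore yields both
  integrability and the value.\<close>

lemma has_bochner_integral_exponential_moment:
  fixes l :: real
  assumes l: "l > 0"
  shows "has_bochner_integral lborel (\<lambda>x. exponential_density l x * x ^ i) (fact i / l ^ i)"
proof (rule has_bochner_integral_nn_integral)
  show "AE x in lborel. 0 \<le> exponential_density l x * x ^ i"
    using l by (intro AE_I2) (simp add: erlang_density_def)
qed (use l nn_integral_erlang_ith_moment[OF l, of 0 i] in auto)

text \<open>Away from 0 the Laplace density is the average of the exponential density of rate
  \<open>1 / b\<close> and its mirror image. Reflection multiplies the moment by
  \<open>(- 1) ^ i\<close>, hence the factor that kills odd moments. One formula thus supplies both
  the mean 0 and the variance \<open>2 * b ^ 2\<close>.\<close>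

lemma has_bochner_integral_laplace_moment:
  assumes "b \<ge> 0"
  shows "has_bochner_integral (laplace b) (\<lambda>x. x ^ i) ((1 + (- 1) ^ i) / 2 * fact i * b ^ i)"
proof (cases "b = 0")
  case True
  have "integrable (return borel (0 :: real)) (\<lambda>x. x ^ i)"
    by (rule integrableI_bounded) (simp_all add: nn_integral_return)
  moreover have "(\<integral>x. x ^ i \<partial>return borel (0 :: real)) = 0 ^ i"
    by (rule integral_return) auto
  ultimately show ?thesis
    \<comment> \<open>For \<open>i = 0\<close> both sides are 1, by the convention
      \<open>0 ^ 0 = 1\<close>.\<close>
    using True by (cases i) (auto simp: laplace_def has_bochner_integral_iff)
next
  case False
  with assms have b: "b > 0" by simp
  let ?e = "exponential_density (1 / b)"
  have pos: "has_bochner_integral lborel (\<lambda>x. ?e x * x ^ i) (fact i * b ^ i)"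
    using has_bochner_integral_exponential_moment[of "1 / b" i] b
    by (simp add: power_one_over field_simps)
  have "has_bochner_integral lborel (\<lambda>x. ?e (- x) * (- x) ^ i) (fact i * b ^ i)"
    using lborel_has_bochner_integral_real_affine_iff[of "- 1" "\<lambda>x. ?e x * x ^ i" "fact i * b ^ i" 0] pos
    by simp
  then have "has_bochner_integral lborel (\<lambda>x. (- 1) ^ i * (?e (- x) * (- x) ^ i))
      ((- 1) ^ i * (fact i * b ^ i))"
    by (rule has_bochner_integral_mult_right)
  from has_bochner_integral_add[OF pos this]
  have sum: "has_bochner_integral lborel
      (\<lambda>x. 1 / 2 * (?e x * x ^ i + (- 1) ^ i * (?e (- x) * (- x) ^ i)))
      (1 / 2 * (fact i * b ^ i + (- 1) ^ i * (fact i * b ^ i)))"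
    by (rule has_bochner_integral_mult_right)
  \<comment> \<open>At 0 both exponential densities are positive, so their average is twice the
    Laplace density there. The identity of densities holds only off this null set.\<close>
  have "AE x in lborel. x \<noteq> (0 :: real)"
    by (rule AE_lborel_singleton)
  then have "AE x in lborel. 1 / 2 * (?e x * x ^ i + (- 1) ^ i * (?e (- x) * (- x) ^ i)) =
      exp (- \<bar>x\<bar> / b) / (2 * b) * x ^ i"
  proof eventually_elim
    fix x :: real
    assume x: "x \<noteq> 0"
    have "(- 1) ^ i * (?e (- x) * (- x) ^ i) = ?e (- x) * x ^ i"
      by (simp add: power_minus[of x])
    moreover have "exp (- \<bar>x\<bar> / b) / (2 * b) = 1 / 2 * (?e x + ?e (- x))"
      using b x by (auto simp: exponential_density_def field_simps abs_if)
    ultimately show "1 / 2 * (?e x * x ^ i + (- 1) ^ i * (?e (- x) * (- x) ^ i)) =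
        exp (- \<bar>x\<bar> / b) / (2 * b) * x ^ i"
      by (simp only:) (simp add: algebra_simps)
  qed
  then have "has_bochner_integral lborel (\<lambda>x. exp (- \<bar>x\<bar> / b) / (2 * b) * x ^ i)
      (1 / 2 * (fact i * b ^ i + (- 1) ^ i * (fact i * b ^ i)))"
    using sum by (subst has_bochner_integral_cong_AE[symmetric]) auto
  then have "has_bochner_integral lborel (\<lambda>x. (exp (- \<bar>x\<bar> / b) / (2 * b)) *\<^sub>R x ^ i)
      ((1 + (- 1) ^ i) / 2 * fact i * b ^ i)"
    by (simp add: algebra_simps add_divide_distrib)
  then show ?thesis
    using b False unfolding laplace_def by (auto intro!: has_bochner_integral_density)
qed

text \<open>Variances of independent centred variables add: when a summand joins, it is independent
  of the sum so far, so the mean of the cross term is a product of two zero means.\<close>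

lemma (in prob_space) has_bochner_integral_indep_sum_square:
  fixes X :: "'i \<Rightarrow> 'a \<Rightarrow> real"
  assumes "finite I" and "indep_vars (\<lambda>_. borel) X I"
    and "\<And>i. i \<in> I \<Longrightarrow> has_bochner_integral M (X i) 0"
    and "\<And>i. i \<in> I \<Longrightarrow> has_bochner_integral M (\<lambda>\<omega>. (X i \<omega>)\<^sup>2) (v i)"
  shows "has_bochner_integral M (\<lambda>\<omega>. (\<Sum>i\<in>I. X i \<omega>)\<^sup>2) (\<Sum>i\<in>I. v i)"
  using assms
proof (induction I rule: finite_induct)
  case empty
  show ?case by (simp add: has_bochner_integral_zero)
next
  case (insert i I)
  let ?S = "\<lambda>\<omega>. \<Sum>j\<in>I. X j \<omega>"
  have indep: "indep_var borel (X i) borel ?S"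
    using insert.hyps insert.prems(1) by (rule indep_vars_sum)
  have Xi: "has_bochner_integral M (X i) 0"
    by (rule insert.prems(2)) simp
  have "has_bochner_integral M ?S (\<Sum>j\<in>I. 0)"
    by (rule has_bochner_integral_sum) (simp add: insert.prems(2))
  then have "has_bochner_integral M (\<lambda>\<omega>. X i \<omega> * ?S \<omega>) 0"
    using Xi indep indep_var_lebesgue_integral[OF indep] indep_var_integrable[OF indep]
    by (auto simp: has_bochner_integral_iff)
  then have cross: "has_bochner_integral M (\<lambda>\<omega>. 2 * (X i \<omega> * ?S \<omega>)) (2 * 0)"
    by (rule has_bochner_integral_mult_right)
  have "has_bochner_integral M (\<lambda>\<omega>. (?S \<omega>)\<^sup>2) (\<Sum>j\<in>I. v j)"
    using insert.prems by (intro insert.IH) (auto intro: indep_vars_subset)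
  from has_bochner_integral_add[OF has_bochner_integral_add[OF insert.prems(3)[OF insertI1] this] cross]
  show ?case
    using insert.hyps by (simp add: power2_sum mult.assoc)
qed

text \<open>Independence amounts to the joint law being the product of the marginals. Here the joint
  law of the coordinates is \<open>PiM I M\<close> itself, and the marginals are the factors
  \<open>M i\<close>.\<close>

lemma indep_vars_PiM_components:
  assumes M: "\<And>i. i \<in> I \<Longrightarrow> prob_space (M i)" and "I \<noteq> {}"
  shows "prob_space.indep_vars (PiM I M) M (\<lambda>i \<omega>. \<omega> i) I"
proof -
  interpret prob_space "PiM I M"
    using M by (rule prob_space_PiM)
  \<comment> \<open>Points of the product space are extensional, so restricting them to
    \<open>I\<close> changes nothing.\<close>
  have "distr (PiM I M) (PiM I M) (\<lambda>x. \<lambda>i\<in>I. x i) = distr (PiM I M) (PiM I M) (\<lambda>x. x)"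
    by (rule distr_cong) (auto simp: space_PiM)
  also have "\<dots> = PiM I (\<lambda>i. distr (PiM I M) (M i) (\<lambda>\<omega>. \<omega> i))"
    using M by (subst distr_id) (intro PiM_cong, simp_all add: distr_PiM_component)
  finally show ?thesis
    using assms(2) by (subst indep_vars_iff_distr_eq_PiM') auto
qed

text \<open>Below the threshold the projection is a point mass at \<open>a\<close>, so the bind
  collapses to its kernel at \<open>a\<close>; since the entries are 0 or 1, the row sum there is
  the degree.\<close>

lemma user_release_eq_distr_laplace:
  assumes "\<epsilon> > 0" and bin: "\<forall>j\<in>{1..n}. a j \<in> {0, 1}"
    and deg: "card (neighbors n a) \<le> dmax"
  shows "user_release n k \<epsilon> dmax a =
    distr (laplace (real (dmax choose (k - 1)) / \<epsilon>)) borel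
      (\<lambda>z. real (card (neighbors n a) choose k) + z)"
proof -
  let ?L = "laplace (real (dmax choose (k - 1)) / \<epsilon>)"
  define K where "K = (\<lambda>a'. distr ?L borel (\<lambda>z. real ((\<Sum>j=1..n. a' j) choose k) + z))"
  interpret L: prob_space ?L
    using assms by (intro prob_space_laplace) simp
  have "prob_space (K a')" "sets (K a') = sets borel" for a'
    unfolding K_def by (rule L.prob_space_distr) measurable
  then have K: "K \<in> measurable (count_space UNIV) (subprob_algebra borel)"
    by (auto simp: space_subprob_algebra prob_space_imp_subprob_space)
  have "user_release n k \<epsilon> dmax a = bind (return (count_space UNIV) a) K"
    using deg by (simp add: user_release_def graph_projection_def K_def Let_def return_pmf.rep_eq)
  also have "\<dots> = K a"
    using K by (rule bind_return) simp
  also have "(\<Sum>j=1..n. a j) = (\<Sum>j\<in>{1..n}. if a j = 1 then 1 else 0)"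
    using bin by (intro sum.cong) auto
  then have "(\<Sum>j=1..n. a j) = card (neighbors n a)"
    by (simp add: neighbors_def sum.If_cases Int_def)
  then have "K a = distr ?L borel (\<lambda>z. real (card (neighbors n a) choose k) + z)"
    by (simp add: K_def)
  finally show ?thesis .
qed

lemma has_bochner_integral_user_release_error:
  assumes "\<epsilon> > 0" and "\<forall>j\<in>{1..n}. a j \<in> {0, 1}"
    and "card (neighbors n a) \<le> dmax"
  shows "has_bochner_integral (user_release n k \<epsilon> dmax a)
      (\<lambda>x. (x - real (card (neighbors n a) choose k)) ^ i)
      ((1 + (- 1) ^ i) / 2 * fact i * (real (dmax choose (k - 1)) / \<epsilon>) ^ i)"
  unfolding user_release_eq_distr_laplace[OF assms]
  by (rule has_bochner_integral_distr)
    (use assms(1) has_bochner_integral_laplace_moment[of "real (dmax choose (k - 1)) / \<epsilon>" i] in auto)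

lemma has_bochner_integral_local_lap_kstar_error:
  assumes "n \<ge> 1" and eps: "\<epsilon> > 0" and A: "adjacency_matrix n A" and deg: "max_degree n A \<le> dmax"
  shows "has_bochner_integral (local_lap_kstar k n A \<epsilon> dmax)
      (\<lambda>x. (x - real (kstar_count k n A))\<^sup>2)
      (real n * (2 * (real (dmax choose (k - 1)) / \<epsilon>)\<^sup>2))"
proof -
  let ?U = "\<lambda>i. user_release n k \<epsilon> dmax (A i)"
  let ?P = "PiM {1..n} ?U"
  let ?r = "\<lambda>i. real (node_degree n A i choose k)"
  let ?X = "\<lambda>i \<omega>. \<omega> i - ?r i"
  have [measurable_cong]: "sets (?U i) = sets borel" for i
    using eps by (rule prob_space_user_release)
  have U: "prob_space (?U i)" for i
    using eps by (rule prob_space_user_release)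
  interpret prob_space ?P
    by (intro prob_space_PiM U)
  have degi: "card (neighbors n (A i)) \<le> dmax" if "i \<in> {1..n}" for i
  proof -
    have "node_degree n A i \<le> max_degree n A"
      unfolding max_degree_def using that by (intro Max_ge) auto
    then show ?thesis
      using deg by (simp add: node_degree_def)
  qed
  \<comment> \<open>The law of a coordinate under the product is the release of that user, so
    moments carry over. Only \<open>p = 1\<close> and \<open>p = 2\<close> are needed below.\<close>
  have moment: "has_bochner_integral ?P (\<lambda>\<omega>. ?X i \<omega> ^ p)
      ((1 + (- 1) ^ p) / 2 * fact p * (real (dmax choose (k - 1)) / \<epsilon>) ^ p)"
    if i: "i \<in> {1..n}" for i p
  proof -
    have "has_bochner_integral (?U i) (\<lambda>x. (x - ?r i) ^ p)
      ((1 + (- 1) ^ p) / 2 * fact p * (real (dmax choose (k - 1)) / \<epsilon>) ^ p)"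
      unfolding node_degree_def
      by (rule has_bochner_integral_user_release_error)
        (use eps A i degi in \<open>auto simp: adjacency_matrix_def\<close>)
    moreover have "distr ?P (?U i) (\<lambda>\<omega>. \<omega> i) = ?U i"
      using U i by (rule distr_PiM_component)
    ultimately have "has_bochner_integral (distr ?P (?U i) (\<lambda>\<omega>. \<omega> i)) (\<lambda>x. (x - ?r i) ^ p)
      ((1 + (- 1) ^ p) / 2 * fact p * (real (dmax choose (k - 1)) / \<epsilon>) ^ p)"
      by simp
    then show ?thesis
      using i by (simp add: has_bochner_integral_iff integrable_distr_eq integral_distr)
  qed
  have "indep_vars ?U (\<lambda>i \<omega>. \<omega> i) {1..n}"
    using assms(1) by (intro indep_vars_PiM_components U) auto
  then have "indep_vars (\<lambda>_. borel) ?X {1..n}"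
    by (rule indep_vars_compose2) measurable
  then have "has_bochner_integral ?P (\<lambda>\<omega>. (\<Sum>i=1..n. ?X i \<omega>)\<^sup>2)
      (\<Sum>i=1..n. 2 * (real (dmax choose (k - 1)) / \<epsilon>)\<^sup>2)"
    using moment[of _ 1] moment[of _ 2]
    by (intro has_bochner_integral_indep_sum_square) auto
  moreover have "(\<Sum>i=1..n. ?X i \<omega>) = (\<Sum>i=1..n. \<omega> i) - real (kstar_count k n A)" for \<omega>
    by (simp add: sum_subtractf kstar_count_def)
  ultimately show ?thesis
    unfolding local_lap_kstar_def by (intro has_bochner_integral_distr) auto
qed

text \<open>Integrability is claimed alongside the bound because the integral of a non-integrable
  function is 0 by convention, which would make the inequality alone hold trivially.\<close>

theorem theorem2:
  shows "\<exists>C::real. \<forall>(n::nat) (k::nat) (\<epsilon>::real) (dmax::nat) (A :: nat \<Rightarrow> nat \<Rightarrow> nat).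
    n \<ge> 1 \<longrightarrow> k \<ge> 1 \<longrightarrow> \<epsilon> > 0 \<longrightarrow> adjacency_matrix n A \<longrightarrow> max_degree n A \<le> dmax \<longrightarrow>
      integrable (local_lap_kstar k n A \<epsilon> dmax) (\<lambda>x. (x - real (kstar_count k n A))\<^sup>2) \<and>
      (\<integral>x. (x - real (kstar_count k n A))\<^sup>2 \<partial>local_lap_kstar k n A \<epsilon> dmax)
        \<le> C * (real n * real dmax ^ (2 * k - 2) / \<epsilon>\<^sup>2)"
proof (intro exI[of _ 2] allI impI)
  fix n k dmax :: nat and \<epsilon> :: real and A :: "nat \<Rightarrow> nat \<Rightarrow> nat"
  assume "n \<ge> 1" "k \<ge> 1" "\<epsilon> > 0" "adjacency_matrix n A" "max_degree n A \<le> dmax"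
  note err = has_bochner_integral_local_lap_kstar_error[OF this(1,3-5), of k]
  have "dmax choose (k - 1) \<le> dmax ^ (k - 1)"
    \<comment> \<open>If \<open>k - 1\<close> exceeds \<open>dmax\<close>, the binomial coefficient
      is 0.\<close>
    by (cases "k - 1 \<le> dmax") (simp_all add: binomial_le_pow binomial_eq_0)
  then have "real (dmax choose (k - 1)) \<le> real dmax ^ (k - 1)"
    by (simp flip: of_nat_power)
  then have "(real (dmax choose (k - 1)))\<^sup>2 \<le> (real dmax ^ (k - 1))\<^sup>2"
    by (intro power_mono) auto
  also have "\<dots> = real dmax ^ (2 * k - 2)"
    by (simp add: diff_mult_distrib2 flip: power_mult mult.commute[of 2])
  finally have "real n * (2 * (real (dmax choose (k - 1)) / \<epsilon>)\<^sup>2) \<le>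
      2 * (real n * real dmax ^ (2 * k - 2) / \<epsilon>\<^sup>2)"
    by (simp add: power_divide mult_left_mono divide_right_mono)
  with err show "integrable (local_lap_kstar k n A \<epsilon> dmax) (\<lambda>x. (x - real (kstar_count k n A))\<^sup>2) \<and>
      (\<integral>x. (x - real (kstar_count k n A))\<^sup>2 \<partial>local_lap_kstar k n A \<epsilon> dmax)
        \<le> 2 * (real n * real dmax ^ (2 * k - 2) / \<epsilon>\<^sup>2)"
    by (simp add: has_bochner_integral_iff)
qed

end
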